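(* Let $\mathcal{T}=(\mathcal{T}_t)_{t\ge0}$, $\mathcal{T}_t=e^{t\mathcal{L}}$, be a quantum Markov semigroup on $M_d(\mathbb{C})$ with generator $\mathcal{L}$. If the Lie algebra rank condition (LARC) holds for some minimal GKSL representation of $\mathcal{L}$, then the quantum Markov semigroup generated by $\mathcal{L}$ is irreducible.
   Context: A quantum Markov semigroup on $M_d(\mathbb{C})$ is here a norm-continuous semigroup $(\mathcal{T}_t)_{t\ge0}$ of completely positive, identity preserving linear maps on $M_d(\mathbb{C})$. GKSL representation: a Gorini-Kossakowski-Sudarshan-Lindblad representation of $\mathcal{L}$ consists of matrices $L_1,\dots,L_m,H\in M_d(\mathbb{C})$ with $H$ self-adjoint such that, with $G=-\frac12\sum_{\ell=1}^m L_\ell^*L_\ell-\mathrm{i}H$, $$\mathcal{L}(x)=G^*x+\sum_{\ell=1}^m L_\ell^*xL_\ell+xG\qquad\text{for all }x\in M_d(\mathbb{C}).$$ It always exists but is not unique; it is called minimal if the number $m$ of operators $L_\ell$ is the smallest possible among all GKSL representations of $\mathcal{L}$. LARC: given a GKSL representation, put $\widetilde{G}=G-\frac12\sum_{\ell=1}^m L_\ell^2$. The LARC holds if for every non-zero $\xi\in\mathbb{C}^d$ the (complex) linear span of the vectors $$\widetilde{G}\xi,\ L_\ell\xi,\ [\widetilde{G},L_\ell]\xi,\ [L_{\ell_1},L_{\ell_2}]\xi,\ [\widetilde{G},[\widetilde{G},L_\ell]]\xi,\ [\widetilde{G},[L_{\ell_1},L_{\ell_2}]]\xi,\ \dots$$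 is equal to $\mathbb{C}^d$; that is, the vectors are all $A\xi$ where $A$ is one of $\widetilde{G},L_1,\dots,L_m$ or any iterated commutator of these matrices ($[A,B]=AB-BA$). Irreducibility: a projection $p\in M_d(\mathbb{C})$ is subharmonic if $\mathcal{T}_t(p)\ge p$ for all $t\ge0$. $\mathcal{T}$ is irreducible if there is no non-trivial (different from $0$ and the identity) subharmonic projection. *)

theory Defs
  imports "HOL-Analysis.Analysis"
begin

text \<open>The algebra of d by d complex matrices is \<open>complex^'n^'n\<close> with \<open>d = CARD('n)\<close>.\<close>

type_synonym 'n cmatrix = "complex^'n^'n"

text \<open>
  Bounded real-linear maps, with the operator norm coming from the Frobenius norm on matrices.
  Complex linearity is the separate predicate \<open>complex_linear\<close>. In finite dimension all norms
  on this space induce the same topology.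
\<close>
type_synonym 'n superop = "'n cmatrix \<Rightarrow>\<^sub>L 'n cmatrix"

definition cscale :: "complex \<Rightarrow> ('n::finite) cmatrix \<Rightarrow> 'n cmatrix" where
  "cscale c A = (\<chi> i j. c * A $ i $ j)"

definition adj :: "('n::finite) cmatrix \<Rightarrow> 'n cmatrix" where
  "adj A = (\<chi> i j. cnj (A $ j $ i))"

definition commutator :: "('n::finite) cmatrix \<Rightarrow> 'n cmatrix \<Rightarrow> 'n cmatrix" where
  "commutator A B = A ** B - B ** A"

text \<open>Conjugate-linear in the first argument; \<open>inner\<close> on \<open>complex^'n\<close> is only its real part.\<close>
definition cinner_vec :: "complex^'n::finite \<Rightarrow> complex^'n \<Rightarrow> complex" where
  "cinner_vec u v = (\<Sum>i\<in>UNIV. cnj (u $ i) * v $ i)"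

definition psd :: "('n::finite) cmatrix \<Rightarrow> bool" where
  "psd A \<longleftrightarrow> (\<forall>v. cinner_vec v (A *v v) \<in> \<real> \<and> 0 \<le> Re (cinner_vec v (A *v v)))"

text \<open>
  A family \<open>X i j\<close> with \<open>i, j < k\<close> is read as the k by k block matrix with these entries,
  acting on k-tuples of vectors.
\<close>
definition block_psd :: "nat \<Rightarrow> (nat \<Rightarrow> nat \<Rightarrow> ('n::finite) cmatrix) \<Rightarrow> bool" where
  "block_psd k X \<longleftrightarrow>
     (\<forall>v. (\<Sum>i<k. \<Sum>j<k. cinner_vec (v i) (X i j *v v j)) \<in> \<real> \<and>
          0 \<le> Re (\<Sum>i<k. \<Sum>j<k. cinner_vec (v i) (X i j *v v j)))"

definition complex_linear :: "('n::finite) superop \<Rightarrow> bool" where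
  "complex_linear \<Phi> \<longleftrightarrow>
     (\<forall>c A. blinfun_apply \<Phi> (cscale c A) = cscale c (blinfun_apply \<Phi> A))"

definition completely_positive :: "('n::finite) superop \<Rightarrow> bool" where
  "completely_positive \<Phi> \<longleftrightarrow>
     (\<forall>k X. block_psd k X \<longrightarrow> block_psd k (\<lambda>i j. blinfun_apply \<Phi> (X i j)))"

definition quantum_markov_semigroup :: "(real \<Rightarrow> ('n::finite) superop) \<Rightarrow> bool" where
  "quantum_markov_semigroup T \<longleftrightarrow>
     T 0 = id_blinfun \<and>
     (\<forall>s\<ge>0. \<forall>t\<ge>0. T (s + t) = T s o\<^sub>L T t) \<and>
     continuous_on {0..} T \<and>
     (\<forall>t\<ge>0. complex_linear (T t) \<and> completely_positive (T t) \<and>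
             blinfun_apply (T t) (mat 1) = mat 1)"

text \<open>
  The library's \<open>exp\<close> needs a normed algebra, which the type of bounded linear maps is not an
  instance of. The series converges absolutely in operator norm.
\<close>
definition superop_exp :: "('n::finite) superop \<Rightarrow> 'n superop" where
  "superop_exp L = (\<Sum>k. (1 / fact k) *\<^sub>R (((o\<^sub>L) L ^^ k) id_blinfun))"

definition gksl_G :: "('n::finite) cmatrix list \<Rightarrow> 'n cmatrix \<Rightarrow> 'n cmatrix" where
  "gksl_G Ls H = - (1/2) *\<^sub>R (\<Sum>K\<leftarrow>Ls. adj K ** K) - cscale \<i> H"

definition gksl_representation ::
    "('n::finite) superop \<Rightarrow> 'n cmatrix list \<Rightarrow> 'n cmatrix \<Rightarrow> bool" where
  "gksl_representation L Ls H \<longleftrightarrow>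
     adj H = H \<and>
     (\<forall>x. blinfun_apply L x =
            adj (gksl_G Ls H) ** x + (\<Sum>K\<leftarrow>Ls. adj K ** x ** K) + x ** gksl_G Ls H)"

definition minimal_gksl_representation ::
    "('n::finite) superop \<Rightarrow> 'n cmatrix list \<Rightarrow> 'n cmatrix \<Rightarrow> bool" where
  "minimal_gksl_representation L Ls H \<longleftrightarrow>
     gksl_representation L Ls H \<and>
     (\<forall>Ls' H'. gksl_representation L Ls' H' \<longrightarrow> length Ls \<le> length Ls')"

definition gksl_Gtilde :: "('n::finite) cmatrix list \<Rightarrow> 'n cmatrix \<Rightarrow> 'n cmatrix" where
  "gksl_Gtilde Ls H = gksl_G Ls H - (1/2) *\<^sub>R (\<Sum>K\<leftarrow>Ls. K ** K)"

inductive_set iterated_commutators :: "('n::finite) cmatrix set \<Rightarrow> 'n cmatrix set"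
  for S :: "'n cmatrix set" where
  base: "A \<in> S \<Longrightarrow> A \<in> iterated_commutators S"
| comm: "A \<in> iterated_commutators S \<Longrightarrow> B \<in> iterated_commutators S \<Longrightarrow>
           commutator A B \<in> iterated_commutators S"

text \<open>\<open>vec.span\<close> is the span over the field of entries, here the complex numbers.\<close>
definition larc :: "('n::finite) cmatrix list \<Rightarrow> 'n cmatrix \<Rightarrow> bool" where
  "larc Ls H \<longleftrightarrow>
     (\<forall>\<xi>. \<xi> \<noteq> 0 \<longrightarrow>
        vec.span {A *v \<xi> | A. A \<in> iterated_commutators (insert (gksl_Gtilde Ls H) (set Ls))}
        = (UNIV :: (complex^'n) set))"

definition projection :: "('n::finite) cmatrix \<Rightarrow> bool" where
  "projection p \<longleftrightarrow> p ** p = p \<and> adj p = p"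

definition subharmonic :: "(real \<Rightarrow> ('n::finite) superop) \<Rightarrow> 'n cmatrix \<Rightarrow> bool" where
  "subharmonic T p \<longleftrightarrow> (\<forall>t\<ge>0. psd (blinfun_apply (T t) p - p))"

definition irreducible_semigroup :: "(real \<Rightarrow> ('n::finite) superop) \<Rightarrow> bool" where
  "irreducible_semigroup T \<longleftrightarrow>
     \<not> (\<exists>p. projection p \<and> subharmonic T p \<and> p \<noteq> 0 \<and> p \<noteq> mat 1)"

end

theory Submission
  imports Defs
begin

text \<open>
  Subharmonicity of a projection \<open>p\<close> gives \<open>\<L>(p) \<ge> 0\<close> by differentiating at \<open>t = 0\<close>, hence
  \<open>\<L>(q) \<le> 0\<close> for \<open>q = 1 - p\<close> because \<open>\<L>(1) = 0\<close>. On the range of \<open>p\<close> the quadratic form of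
  \<open>\<L>(q)\<close> is \<open>v \<mapsto> \<Sum>\<^sub>\<ell> \<parallel>q L\<^sub>\<ell> v\<parallel>\<^sup>2\<close>, so every \<open>L\<^sub>\<ell>\<close> leaves this range invariant; then \<open>\<L>(q) v = q G v\<close>,
  and a vector on which a semidefinite form vanishes is in its kernel, so \<open>G\<close> leaves it invariant as well.
  All iterated commutators then preserve the range of \<open>p\<close>, which contradicts the rank condition
  at any nonzero vector of the range unless \<open>p\<close> is the identity.
\<close>

section \<open>Adjoints and the quadratic form of the generator\<close>

lemma inner_eq_Re_cinner_vec: "u \<bullet> v = Re (cinner_vec u v)"
  by (simp add: inner_vec_def cinner_vec_def inner_complex_def)

lemma inner_adj: "u \<bullet> (adj A *v v) = (A *v u) \<bullet> v"
proof -
  have "cinner_vec u (adj A *v v) = cinner_vec (A *v u) v"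
    unfolding cinner_vec_def matrix_vector_mult_def adj_def
    by (simp add: sum_distrib_left sum_distrib_right mult_ac) (rule sum.swap)
  then show ?thesis
    by (simp add: inner_eq_Re_cinner_vec)
qed

lemma adj_add: "adj (A + B) = adj A + adj B"
  by (simp add: adj_def vec_eq_iff)

lemma adj_diff: "adj (A - B) = adj A - adj B"
  by (simp add: adj_def vec_eq_iff)

lemma adj_scaleR: "adj (r *\<^sub>R A) = r *\<^sub>R adj A"
  by (simp add: adj_def vec_eq_iff)

lemma adj_mat_1: "adj (mat 1) = mat 1"
  by (auto simp: adj_def mat_def vec_eq_iff)

lemma adj_adj: "adj (adj A) = A"
  by (simp add: adj_def vec_eq_iff)

lemma adj_mult: "adj (A ** B) = adj B ** adj A"
  by (simp add: adj_def matrix_matrix_mult_def vec_eq_iff mult.commute)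

lemma adj_cscale: "adj (cscale c A) = cscale (cnj c) (adj A)"
  by (simp add: adj_def cscale_def vec_eq_iff)

lemma adj_sum_list_gram: "adj (\<Sum>K\<leftarrow>Ls. adj K ** K) = (\<Sum>K\<leftarrow>Ls. adj K ** K)"
proof (induction Ls)
  case Nil
  then show ?case by (simp add: adj_def vec_eq_iff)
qed (simp add: adj_add adj_mult adj_adj)

text \<open>The \<open>H\<close> terms cancel because \<open>adj\<close> conjugates the factor
  \<open>cscale \<i>\<close>, and the two halves of the Gram sum in \<open>gksl_G\<close> and its
  adjoint cancel the full sum.\<close>

lemma gksl_normalization:
  assumes "adj H = H"
  shows "adj (gksl_G Ls H) + (\<Sum>K\<leftarrow>Ls. adj K ** K) + gksl_G Ls H = 0"
proof -
  have "cscale (- \<i>) H = - cscale \<i> H"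
    by (simp add: cscale_def vec_eq_iff)
  then have "adj (gksl_G Ls H) = - (1/2) *\<^sub>R (\<Sum>K\<leftarrow>Ls. adj K ** K) + cscale \<i> H"
    using assms unfolding gksl_G_def
    by (simp only: adj_diff adj_scaleR adj_sum_list_gram adj_cscale) simp
  then show ?thesis
    unfolding gksl_G_def by (simp add: scaleR_left_distrib[symmetric])
qed

lemma gksl_apply_one:
  assumes "gksl_representation L Ls H"
  shows "blinfun_apply L (mat 1) = 0"
  using assms gksl_normalization[of H Ls]
  by (simp add: gksl_representation_def)

lemma scaleR_matrix_vector_mult: "(r *\<^sub>R A) *v v = r *\<^sub>R (A *v v)"
  for A :: "complex^'n^'m"
  by (simp add: matrix_vector_mult_def vec_eq_iff scaleR_sum_right)

lemma matrix_vector_mult_scaleR_right: "A *v (r *\<^sub>R v) = r *\<^sub>R (A *v v)"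
  for A :: "complex^'n^'m"
  by (simp add: matrix_vector_mult_def vec_eq_iff scaleR_sum_right)

lemma sum_list_matrix_vector: "(\<Sum>K\<leftarrow>Ls. f K) *v v = (\<Sum>K\<leftarrow>Ls. f K *v v)"
  for f :: "'a \<Rightarrow> complex^'n^'m"
  by (induction Ls) (simp_all add: matrix_vector_mult_add_rdistrib)

lemma inner_sum_list_right: "u \<bullet> (\<Sum>x\<leftarrow>xs. f x) = (\<Sum>x\<leftarrow>xs. u \<bullet> f x)"
  by (induction xs) (simp_all add: inner_add_right)

lemma gksl_form:
  assumes "gksl_representation L Ls H"
  shows "u \<bullet> (blinfun_apply L x *v v) =
    (gksl_G Ls H *v u) \<bullet> (x *v v) + (\<Sum>K\<leftarrow>Ls. (K *v u) \<bullet> (x *v (K *v v)))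
      + u \<bullet> (x *v (gksl_G Ls H *v v))"
  using assms
  by (simp add: gksl_representation_def matrix_vector_mult_add_rdistrib inner_add_right
      sum_list_matrix_vector inner_sum_list_right inner_adj matrix_vector_mul_assoc[symmetric])

section \<open>The exponential series and its derivative at time zero\<close>

lemma norm_blinfun_power_le: "norm (((o\<^sub>L) L ^^ k) id_blinfun) \<le> norm L ^ k"
  for L :: "'a::real_normed_vector \<Rightarrow>\<^sub>L 'a"
proof (induction k)
  case 0
  then show ?case using norm_blinfun_id_le by simp
next
  case (Suc k)
  have "norm (L o\<^sub>L ((o\<^sub>L) L ^^ k) id_blinfun) \<le> norm L * norm (((o\<^sub>L) L ^^ k) id_blinfun)"
    by (rule norm_blinfun_compose)
  also have "\<dots> \<le> norm L * norm L ^ k"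
    using Suc by (simp add: mult_left_mono)
  finally show ?case by simp
qed

lemma blinfun_power_scaleR:
  "((o\<^sub>L) (t *\<^sub>R L) ^^ k) id_blinfun = t ^ k *\<^sub>R ((o\<^sub>L) L ^^ k) id_blinfun"
  for L :: "'a::real_normed_vector \<Rightarrow>\<^sub>L 'a"
  by (induction k)
    (auto intro!: blinfun_eqI simp: blinfun.scaleR_left blinfun.scaleR_right)

lemma summable_superop_exp:
  "summable (\<lambda>k. (1 / fact k) *\<^sub>R (((o\<^sub>L) L ^^ k) id_blinfun))"
  for L :: "('n::finite) superop"
proof (rule summable_comparison_test)
  show "\<exists>N. \<forall>k\<ge>N. norm ((1 / fact k) *\<^sub>R (((o\<^sub>L) L ^^ k) id_blinfun)) \<le> inverse (fact k) * norm L ^ k"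
    using norm_blinfun_power_le[of _ L] by (auto simp: divide_simps)
  show "summable (\<lambda>k. inverse (fact k) * norm L ^ k)"
    by (rule summable_exp)
qed

text \<open>Applying \<open>\<phi>\<close> term by term turns the operator series into a real power
  series in \<open>t\<close>, which can be differentiated termwise.\<close>

lemma superop_exp_deriv_at_0:
  fixes \<phi> :: "('n::finite) superop \<Rightarrow> real"
  assumes "bounded_linear \<phi>"
  shows "((\<lambda>t. \<phi> (superop_exp (t *\<^sub>R L))) has_real_derivative \<phi> L) (at 0)"
proof -
  interpret bounded_linear \<phi> by fact
  define c where "c k = \<phi> (((o\<^sub>L) L ^^ k) id_blinfun) / fact k" for k
  have coeff: "\<phi> ((1 / fact k) *\<^sub>R (((o\<^sub>L) (t *\<^sub>R L) ^^ k) id_blinfun)) = c k * t ^ k" for k t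
    by (simp add: c_def scaleR blinfun_power_scaleR)
  have eq: "\<phi> (superop_exp (t *\<^sub>R L)) = (\<Sum>k. c k * t ^ k)" for t
    unfolding superop_exp_def by (simp only: suminf[OF summable_superop_exp] coeff)
  have "summable (\<lambda>k. c k * t ^ k)" for t
    using summable[OF summable_superop_exp[of "t *\<^sub>R L"]] by (simp only: coeff)
  then have "((\<lambda>t. \<Sum>k. c k * t ^ k) has_real_derivative (\<Sum>k. diffs c k * 0 ^ k)) (at 0)"
    by (rule termdiffs_strong_converges_everywhere)
  \<comment> \<open>At 0 only the constant term \<open>diffs c 0 = c 1\<close> survives, and
    \<open>c 1\<close> is \<open>\<phi>\<close> of \<open>L\<close> composed with the
    identity.\<close>
  moreover have "(\<Sum>k. diffs c k * 0 ^ k) = \<phi> L"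
    unfolding powser_zero by (auto simp: diffs_def c_def intro!: arg_cong[of _ _ \<phi>] blinfun_eqI)
  ultimately show ?thesis
    by (simp add: eq)
qed

lemma superop_exp_zero: "superop_exp (0 :: ('a::finite) superop) = id_blinfun"
proof -
  have "(\<lambda>k. (1 / fact k) *\<^sub>R (((o\<^sub>L) (0 :: 'a superop) ^^ k) id_blinfun)) =
      (\<lambda>k. if k = 0 then id_blinfun else 0)"
  proof
    fix k show "(1 / fact k) *\<^sub>R (((o\<^sub>L) (0 :: 'a superop) ^^ k) id_blinfun) =
      (if k = 0 then id_blinfun else 0)"
      by (cases k) auto
  qed
  then show ?thesis
    using sums_unique[OF sums_single[of 0 "\<lambda>_. id_blinfun :: 'a superop"]]
    by (simp only: superop_exp_def)
qed

text \<open>A negative value would be a negative right derivative of the form of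
  \<open>T t p\<close> at \<open>v\<close>, so this form would drop below its initial value at small
  times, against subharmonicity.\<close>

lemma subharmonic_generator_nonneg:
  assumes T: "\<And>t. t \<ge> 0 \<Longrightarrow> T t = superop_exp (t *\<^sub>R L)"
    and sub: "subharmonic T p"
  shows "0 \<le> v \<bullet> (blinfun_apply L p *v v)"
proof (rule ccontr)
  define \<phi> where "\<phi> \<Phi> = v \<bullet> (blinfun_apply \<Phi> p *v v)" for \<Phi> :: "'a superop"
  have "linear (\<lambda>A :: 'a cmatrix. v \<bullet> (A *v v))"
    by (rule linearI)
      (simp_all add: matrix_vector_mult_add_rdistrib inner_add_right
        scaleR_matrix_vector_mult)
  then have bl: "bounded_linear \<phi>"
    unfolding \<phi>_def linear_conv_bounded_linear
    by (rule bounded_linear_compose) (rule blinfun.bounded_linear_left)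
  assume "\<not> 0 \<le> v \<bullet> (blinfun_apply L p *v v)"
  then obtain d where d: "d > 0"
      "\<And>h. 0 < h \<Longrightarrow> h < d \<Longrightarrow> \<phi> (superop_exp (h *\<^sub>R L)) < \<phi> (superop_exp (0 *\<^sub>R L))"
    using DERIV_neg_dec_right[OF superop_exp_deriv_at_0[OF bl, of L]]
    by (auto simp: \<phi>_def)
  have "psd (blinfun_apply (T (d/2)) p - p)"
    using sub d(1) by (simp add: subharmonic_def)
  then have "\<phi> (T (d/2)) \<ge> \<phi> id_blinfun"
    by (simp add: psd_def inner_eq_Re_cinner_vec[symmetric] \<phi>_def
        matrix_vector_mult_diff_rdistrib inner_diff_right)
  moreover have "\<phi> (T (d/2)) < \<phi> id_blinfun"
    using d(2)[of "d/2"] d(1) T[of "d/2"] by (simp add: superop_exp_zero)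
  ultimately show False by simp
qed

section \<open>Invariance of the kernel of a projection whose image under the generator is
  nonpositive\<close>

lemma projection_inner:
  assumes "projection q"
  shows "(q *v u) \<bullet> (q *v v) = u \<bullet> (q *v v)"
  using assms inner_adj[of u q "q *v v"]
  by (simp add: projection_def matrix_vector_mul_assoc)

lemma projection_complement:
  assumes "projection p"
  shows "projection (mat 1 - p)"
  using assms
  by (simp add: projection_def adj_diff adj_mat_1 matrix_eq matrix_vector_mul_assoc[symmetric]
      matrix_vector_mult_diff_rdistrib matrix_vector_mult_diff_distrib)

lemma nonpos_form_kernel_invariant:
  assumes rep: "gksl_representation L Ls H" and q: "projection q"
    and le: "\<And>u. u \<bullet> (blinfun_apply L q *v u) \<le> 0"
    and v: "q *v v = 0"
  shows "\<forall>K\<in>set Ls. q *v (K *v v) = 0" and "q *v (gksl_G Ls H *v v) = 0"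
proof -
  note form = gksl_form[OF rep, of _ q]
  have symm: "u \<bullet> (q *v w) = (q *v u) \<bullet> w" for u w
    using inner_adj[of u q w] q by (simp add: projection_def)
  have "v \<bullet> (blinfun_apply L q *v v) = (\<Sum>K\<leftarrow>Ls. (K *v v) \<bullet> (q *v (K *v v)))"
    using v by (simp add: form symm)
  also have "\<dots> = (\<Sum>K\<leftarrow>Ls. (q *v (K *v v)) \<bullet> (q *v (K *v v)))"
    by (simp add: projection_inner[OF q])
  finally have "(\<Sum>K\<leftarrow>Ls. (q *v (K *v v)) \<bullet> (q *v (K *v v))) \<le> 0"
    using le[of v] by simp
  moreover have "(\<Sum>K\<leftarrow>Ls. (q *v (K *v v)) \<bullet> (q *v (K *v v))) \<ge> 0"
    by (rule sum_list_nonneg) auto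
  ultimately have "(\<Sum>K\<leftarrow>Ls. (q *v (K *v v)) \<bullet> (q *v (K *v v))) = 0"
    by simp
  then have "\<forall>x\<in>set (map (\<lambda>K. (q *v (K *v v)) \<bullet> (q *v (K *v v))) Ls). x = 0"
    by (subst (asm) sum_list_nonneg_eq_0_iff) auto
  then show K0: "\<forall>K\<in>set Ls. q *v (K *v v) = 0"
    by simp
  \<comment> \<open>This vector is to be shown zero; it also serves as the direction in which
    \<open>v\<close> is perturbed.\<close>
  define w where "w = q *v (gksl_G Ls H *v v)"
  define B where "B = blinfun_apply L q"
  have qw: "q *v w = w"
    using q by (simp add: w_def projection_def matrix_vector_mul_assoc matrix_mul_assoc)
  \<comment> \<open>The cross terms vanish against every \<open>u\<close>, on either side, since
    \<open>q\<close> is self-adjoint and kills each \<open>K *v v\<close>.\<close>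
  have Ks: "(\<Sum>K\<leftarrow>Ls. (K *v u) \<bullet> (q *v (K *v v))) = 0"
    "(\<Sum>K\<leftarrow>Ls. (K *v v) \<bullet> (q *v (K *v u))) = 0" for u
    using K0 by (auto simp: symm[of "_ *v v"] intro!: sum_list_0 cong: map_cong)
  have wBv: "w \<bullet> (B *v v) = w \<bullet> w"
    using v by (simp add: B_def form Ks w_def)
  have "v \<bullet> (B *v w) = (gksl_G Ls H *v v) \<bullet> (q *v w)"
    using v by (simp add: B_def form Ks symm[of v])
  then have vBw: "v \<bullet> (B *v w) = w \<bullet> w"
    by (simp add: symm w_def[symmetric])
  have vBv: "v \<bullet> (B *v v) = 0"
    using v by (simp add: B_def form Ks symm[of v])
  define c where "c = w \<bullet> (B *v w)"
  \<comment> \<open>The form at \<open>v + t w\<close> has no constant term, so the inequality can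
    be divided by \<open>t > 0\<close>; letting \<open>t\<close> tend to 0 then leaves only the
    linear coefficient \<open>2 * (w \<bullet> w)\<close>.\<close>
  have ineq: "2 * (w \<bullet> w) + t * c \<le> 0" if "t > 0" for t :: real
  proof -
    have "(v + t *\<^sub>R w) \<bullet> (B *v (v + t *\<^sub>R w)) = t * (2 * (w \<bullet> w) + t * c)"
      by (simp add: matrix_vector_right_distrib matrix_vector_mult_scaleR_right inner_add_left
          inner_add_right vBv vBw wBv c_def algebra_simps)
    then show ?thesis
      using le[of "v + t *\<^sub>R w"] that by (simp add: B_def mult_le_0_iff)
  qed
  have "((\<lambda>t. 2 * (w \<bullet> w) + t * c) \<longlongrightarrow> 2 * (w \<bullet> w) + 0 * c) (at_right 0)"
    by (intro tendsto_intros)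
  then have "2 * (w \<bullet> w) + 0 * c \<le> 0"
    by (rule tendsto_upperbound) (auto intro: eventually_mono[OF eventually_at_right_less] ineq)
  then show "q *v (gksl_G Ls H *v v) = 0"
    using inner_gt_zero_iff[of w] by (fastforce simp: w_def[symmetric])
qed

section \<open>Iterated commutators and the rank condition\<close>

lemma iterated_commutators_invariant:
  assumes "A \<in> iterated_commutators S"
    and "\<And>B v. B \<in> S \<Longrightarrow> v \<in> V \<Longrightarrow> B *v v \<in> V"
    and "vec.subspace V" and "v \<in> V"
  shows "A *v v \<in> V"
  using assms(1,4)
\<comment> \<open>In a commutator each factor acts on the image of \<open>v\<close> under the other,
  so the induction hypotheses are needed at other vectors of \<open>V\<close>.\<close>
proof (induction arbitrary: v)
  case (base A)
  then show ?case by (simp add: assms(2))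
next
  case (comm A B)
  then show ?case
    using vec.subspace_diff[OF assms(3)]
    by (simp add: commutator_def matrix_vector_mult_diff_rdistrib matrix_vector_mul_assoc[symmetric])
qed

text \<open>Closure under complex scalars is what keeps the complex span of the rank condition
  inside the kernel.\<close>

lemma vec_subspace_kernel: "vec.subspace {v. q *v v = 0}" for q :: "('n::finite) cmatrix"
  by (simp add: vec.subspace_def matrix_vector_right_distrib vector_scalar_commute)

lemma gksl_Gtilde_mult:
  "gksl_Gtilde Ls H *v v = gksl_G Ls H *v v - (1/2) *\<^sub>R (\<Sum>K\<leftarrow>Ls. K *v (K *v v))"
  by (simp add: gksl_Gtilde_def matrix_vector_mult_diff_rdistrib
      scaleR_matrix_vector_mult sum_list_matrix_vector matrix_vector_mul_assoc)

lemma matrix_vector_sum_list: "q *v (\<Sum>x\<leftarrow>xs. f x) = (\<Sum>x\<leftarrow>xs. q *v f x)"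
  for q :: "complex^'n^'m"
  by (induction xs) (simp_all add: matrix_vector_right_distrib)

theorem theorem11:
  fixes T :: "real \<Rightarrow> ('n::finite) superop" and L :: "'n superop"
  assumes "quantum_markov_semigroup T"
    and "\<And>t. t \<ge> 0 \<Longrightarrow> T t = superop_exp (t *\<^sub>R L)"
    and "\<exists>Ls H. minimal_gksl_representation L Ls H \<and> larc Ls H"
  shows "irreducible_semigroup T"
  unfolding irreducible_semigroup_def
proof clarify
  fix p :: "'n cmatrix"
  assume p: "projection p" and sub: "subharmonic T p" and "p \<noteq> 0" and "p \<noteq> mat 1"
  obtain Ls H where rep: "gksl_representation L Ls H" and larc: "larc Ls H"
    using assms(3) by (auto simp: minimal_gksl_representation_def)
  define q where "q = mat 1 - p"
  \<comment> \<open>As \<open>p\<close> is a projection, the kernel of \<open>1 - p\<close> is the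
    range of \<open>p\<close>.\<close>
  define V where "V = {v. q *v v = 0}"
  have q: "projection q"
    unfolding q_def by (rule projection_complement[OF p])
  have "blinfun_apply L q = - blinfun_apply L p"
    using gksl_apply_one[OF rep] by (simp add: q_def blinfun.diff_right)
  \<comment> \<open>The instance with first matrix 0 moves the minus sign out of the matrix-vector
    product.\<close>
  then have "u \<bullet> (blinfun_apply L q *v u) \<le> 0" for u
    using subharmonic_generator_nonneg[OF assms(2) sub, of u]
      matrix_vector_mult_diff_rdistrib[of 0 "blinfun_apply L p" u] by simp
  note inv = nonpos_form_kernel_invariant[OF rep q this]
  have V: "vec.subspace V"
    unfolding V_def by (rule vec_subspace_kernel)
  have gen: "B *v v \<in> V" if B: "B \<in> insert (gksl_Gtilde Ls H) (set Ls)" and v: "v \<in> V" for B v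
  proof -
    \<comment> \<open>Stated for every kernel vector \<open>u\<close>, because the squares in
      \<open>gksl_Gtilde\<close> require it twice: at \<open>v\<close> and at
      \<open>K *v v\<close>.\<close>
    have K: "q *v (K *v u) = 0" if "K \<in> set Ls" "q *v u = 0" for K u
      using inv(1) that by blast
    have "(\<Sum>K\<leftarrow>Ls. q *v (K *v (K *v v))) = 0"
      using K v by (auto simp: V_def intro!: sum_list_0 cong: map_cong)
    then have "q *v (gksl_Gtilde Ls H *v v) = 0"
      using inv(2) v
      by (simp add: V_def gksl_Gtilde_mult matrix_vector_mult_diff_distrib
          matrix_vector_mult_scaleR_right matrix_vector_sum_list)
    then show ?thesis
      using K B v by (auto simp: V_def)
  qed
  \<comment> \<open>The vector \<open>p *v x\<close> is the nonzero element of \<open>V\<close> at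
    which the rank condition is tested.\<close>
  obtain x where x: "p *v x \<noteq> 0"
    using \<open>p \<noteq> 0\<close> matrix_eq[of p 0] by auto
  have xV: "p *v x \<in> V"
    using p by (simp add: V_def q_def matrix_vector_mult_diff_rdistrib projection_def
        matrix_vector_mul_assoc)
  have "vec.span {A *v (p *v x) | A. A \<in> iterated_commutators (insert (gksl_Gtilde Ls H) (set Ls))} \<subseteq> V"
    using iterated_commutators_invariant[OF _ gen V xV] by (intro vec.span_minimal V) blast
  then have "V = UNIV"
    using larc x unfolding larc_def by blast
  then have "q = 0"
    using matrix_eq[of q 0] by (auto simp: V_def)
  then show False
    using \<open>p \<noteq> mat 1\<close> by (simp add: q_def)
qed

end
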